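(* Let $m,n\ge 1$ be integers, $q>0$, $a>0$, $b,c,d\ge 0$. Consider the directed grid $G_{m,n}$ with source $s=(0,0)$, sink $t=(m,n)$, total demand $q$, and latency $\ell(x)=ax+b$ on every grid edge, and add a chord $u\to v$ with latency $\ell_*(x)=cx+d$. Let $z^*$ be the flow on the chord in the User Equilibrium of the augmented network. If $z^*\in(0,q]$, then the difference in total travel times satisfies \[ C_{\mathrm{new}}-C_{\mathrm{old}}\ \le\ -V_{uv}\,z^*. \] Consequently, $V_{uv}<0$ is necessary for Braess' Paradox: if $C_{\mathrm{new}}>C_{\mathrm{old}}$, then $V_{uv}<0$.
   Context: Grid: $G_{m,n}=(V,E)$ is the directed graph with vertex set $V=\{0,\dots,m\}\times\{0,\dots,n\}$ and directed edges $(i,j)\to(i+1,j)$ for $i<m$ and $(i,j)\to(i,j+1)$ for $j<n$. Chord: an added directed edge $u\to v$ with $u,v\in V$, $u\ne v$, such that $uv$ is not an edge of the underlying undirected grid. Feasible flow (in the grid, or in the grid plus chord): a nonnegative number $f_e$ for each directed edge $e$, with flow conserved at every vertex other than $s,t$, and net outflow from $s$ and net inflow to $t$ both equal to $q$. Its cost (total travel time) is $C(f)=\sum_e f_e\ell_e(f_e)$. User Equilibrium: a feasible flow, decomposable into flows along $s$-$t$ paths, such that every path carrying positive flow has latency (sum of $\ell_e(f_e)$ over its edges) no larger than that of any other $s$-$t$ path. By a classical theorem (Beckmann, McGuire, Winsten) these are exactly the minimizers over feasible flows of the Beckmann potential $Z(f)=\sum_e\int_0^{f_e}\ell_e(y)\,dy$;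 in the networks considered here the minimizer is unique. $C_{\mathrm{old}}$ is the cost of the User Equilibrium of $G_{m,n}$; $C_{\mathrm{new}}$ is the cost of the User Equilibrium of $G_{m,n}$ with the chord added (same $s,t,q$). Braess' Paradox occurs when $C_{\mathrm{new}}/C_{\mathrm{old}}>1$. Electrical quantities: $\mathsf L$ is the weighted graph Laplacian of the underlying undirected grid in which every edge has resistance $a$ (so diagonal entries are $\deg/a$ and off-diagonal entries are $-1/a$ for adjacent vertices and $0$ otherwise), $\mathsf L^+$ is its Moore--Penrose pseudoinverse, $\mathbf e_w\in\mathbb R^{V}$ is the standard basis vector at $w$, and $V_{uv}=q(\mathbf e_s-\mathbf e_t)^{\mathsf T}\mathsf L^+(\mathbf e_u-\mathbf e_v)$. *)

theory Defs
  imports Complex_Main "Graph_Theory.Graph_Theory"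
begin

section \<open>Selfish routing: flows and user equilibria\<close>

text \<open>A path is a directed walk without repeated vertices, given as its list of arcs.\<close>

definition st_paths :: "('v, 'e) pre_digraph \<Rightarrow> 'v \<Rightarrow> 'v \<Rightarrow> 'e list set" where
  "st_paths G s t = {p. pre_digraph.apath G s p t}"

definition feasible_flow ::
  "('v, 'e) pre_digraph \<Rightarrow> 'v \<Rightarrow> 'v \<Rightarrow> real \<Rightarrow> ('e \<Rightarrow> real) \<Rightarrow> bool" where
  "feasible_flow G s t q f \<longleftrightarrow>
     (\<forall>e \<in> arcs G. 0 \<le> f e) \<and>
     (\<forall>w \<in> verts G - {s, t}. sum f (out_arcs G w) = sum f (in_arcs G w)) \<and>
     sum f (out_arcs G s) - sum f (in_arcs G s) = q \<and>
     sum f (in_arcs G t) - sum f (out_arcs G t) = q"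

definition total_travel_time ::
  "('v, 'e) pre_digraph \<Rightarrow> ('e \<Rightarrow> real \<Rightarrow> real) \<Rightarrow> ('e \<Rightarrow> real) \<Rightarrow> real" where
  "total_travel_time G lat f = (\<Sum>e \<in> arcs G. f e * lat e (f e))"

definition path_latency :: "('e \<Rightarrow> real \<Rightarrow> real) \<Rightarrow> ('e \<Rightarrow> real) \<Rightarrow> 'e list \<Rightarrow> real" where
  "path_latency lat f p = (\<Sum>e \<leftarrow> p. lat e (f e))"

text \<open>\<open>h p\<close> is the amount of flow routed along the path \<open>p\<close>.\<close>

definition user_equilibrium ::
  "('v, 'e) pre_digraph \<Rightarrow> ('e \<Rightarrow> real \<Rightarrow> real) \<Rightarrow> 'v \<Rightarrow> 'v \<Rightarrow> real \<Rightarrow> ('e \<Rightarrow> real) \<Rightarrow> bool" where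
  "user_equilibrium G lat s t q f \<longleftrightarrow>
     feasible_flow G s t q f \<and>
     (\<exists>h. (\<forall>p \<in> st_paths G s t. 0 \<le> h p) \<and>
          (\<forall>e \<in> arcs G. f e = (\<Sum>p \<in> {p \<in> st_paths G s t. e \<in> set p}. h p)) \<and>
          (\<forall>p \<in> st_paths G s t. 0 < h p \<longrightarrow>
             (\<forall>p' \<in> st_paths G s t. path_latency lat f p \<le> path_latency lat f p')))"


section \<open>The directed grid and chords\<close>

definition grid :: "nat \<Rightarrow> nat \<Rightarrow> (nat \<times> nat) pair_pre_digraph" where
  "grid m n =
     \<lparr> pverts = {0..m} \<times> {0..n},
       parcs = {((i, j), (Suc i, j)) | i j. i < m \<and> j \<le> n} \<union>
               {((i, j), (i, Suc j)) | i j. i \<le> m \<and> j < n} \<rparr>"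

definition is_chord :: "'v pair_pre_digraph \<Rightarrow> 'v \<Rightarrow> 'v \<Rightarrow> bool" where
  "is_chord G u v \<longleftrightarrow>
     u \<in> pverts G \<and> v \<in> pverts G \<and> u \<noteq> v \<and> (u, v) \<notin> parcs (mk_symmetric G)"

abbreviation add_chord ::
  "'v pair_pre_digraph \<Rightarrow> 'v \<Rightarrow> 'v \<Rightarrow> ('v, 'v \<times> 'v) pre_digraph" where
  "add_chord G u v \<equiv> pre_digraph.add_arc (with_proj G) (u, v)"

definition grid_latency :: "real \<Rightarrow> real \<Rightarrow> 'e \<Rightarrow> real \<Rightarrow> real" where
  "grid_latency a b e x = a * x + b"

definition chord_latency ::
  "real \<Rightarrow> real \<Rightarrow> real \<Rightarrow> real \<Rightarrow> 'v \<Rightarrow> 'v \<Rightarrow> 'v \<times> 'v \<Rightarrow> real \<Rightarrow> real" where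
  "chord_latency a b c d u v e x = (if e = (u, v) then c * x + d else grid_latency a b e x)"


section \<open>Electrical quantities\<close>

text \<open>Real square matrices with rows and columns indexed by a finite set \<open>I\<close> are functions
  \<open>'i \<Rightarrow> 'i \<Rightarrow> real\<close> of which only the entries in \<open>I \<times> I\<close> matter.\<close>

definition mat_prod ::
  "'i set \<Rightarrow> ('i \<Rightarrow> 'i \<Rightarrow> real) \<Rightarrow> ('i \<Rightarrow> 'i \<Rightarrow> real) \<Rightarrow> 'i \<Rightarrow> 'i \<Rightarrow> real" where
  "mat_prod I A B x y = (\<Sum>k \<in> I. A x k * B k y)"

definition mat_eq_on :: "'i set \<Rightarrow> ('i \<Rightarrow> 'i \<Rightarrow> real) \<Rightarrow> ('i \<Rightarrow> 'i \<Rightarrow> real) \<Rightarrow> bool" where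
  "mat_eq_on I A B \<longleftrightarrow> (\<forall>x \<in> I. \<forall>y \<in> I. A x y = B x y)"

definition mat_transp :: "('i \<Rightarrow> 'i \<Rightarrow> real) \<Rightarrow> 'i \<Rightarrow> 'i \<Rightarrow> real" where
  "mat_transp A x y = A y x"

text \<open>The four Penrose conditions. The entries outside \<open>I \<times> I\<close> are fixed to be 0, so that
  the pseudoinverse is unique as a function.\<close>

definition is_pseudoinverse ::
  "'i set \<Rightarrow> ('i \<Rightarrow> 'i \<Rightarrow> real) \<Rightarrow> ('i \<Rightarrow> 'i \<Rightarrow> real) \<Rightarrow> bool" where
  "is_pseudoinverse I A X \<longleftrightarrow>
     mat_eq_on I (mat_prod I (mat_prod I A X) A) A \<and>
     mat_eq_on I (mat_prod I (mat_prod I X A) X) X \<and>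
     mat_eq_on I (mat_transp (mat_prod I A X)) (mat_prod I A X) \<and>
     mat_eq_on I (mat_transp (mat_prod I X A)) (mat_prod I X A) \<and>
     (\<forall>x y. x \<notin> I \<or> y \<notin> I \<longrightarrow> X x y = 0)"

definition pseudoinverse :: "'i set \<Rightarrow> ('i \<Rightarrow> 'i \<Rightarrow> real) \<Rightarrow> 'i \<Rightarrow> 'i \<Rightarrow> real" where
  "pseudoinverse I A = (THE X. is_pseudoinverse I A X)"

text \<open>Laplacian of the underlying undirected graph, every edge having resistance \<open>a\<close>.\<close>

definition laplacian :: "'v pair_pre_digraph \<Rightarrow> real \<Rightarrow> 'v \<Rightarrow> 'v \<Rightarrow> real" where
  "laplacian G a x y =
     (if x = y then real (card {w. (x, w) \<in> parcs (mk_symmetric G)}) / a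
      else if (x, y) \<in> parcs (mk_symmetric G) then - 1 / a
      else 0)"

definition basis_vec :: "'v \<Rightarrow> 'v \<Rightarrow> real" where
  "basis_vec w x = (if x = w then 1 else 0)"

definition potential_diff ::
  "'v pair_pre_digraph \<Rightarrow> real \<Rightarrow> real \<Rightarrow> 'v \<Rightarrow> 'v \<Rightarrow> 'v \<Rightarrow> 'v \<Rightarrow> real" where
  "potential_diff G a q s t u v =
     q * (\<Sum>x \<in> pverts G. \<Sum>y \<in> pverts G.
            (basis_vec s x - basis_vec t x) *
            pseudoinverse (pverts G) (laplacian G a) x y *
            (basis_vec u y - basis_vec v y))"

end

theory Submission
  imports Defs
begin

text \<open>The electrical current driven from one corner of the grid to the opposite corner flows along the
  arcs everywhere, by a minimum principle for the differences of its potential \<open>\<phi>\<close>. All paths of the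
  grid have the same length, so the constant term of the latency is irrelevant, the current is a user
  equilibrium, and by the variational inequality it is the only one: \<open>a f(x,y) = \<phi>(x) - \<phi>(y)\<close>.

  For the equilibrium \<open>g\<close> of the augmented network, the variational inequality tested against \<open>f\<close> gives
  \<open>C_new \<le> \<Sum> f (a g + b) = \<Sum> (\<phi>(x) - \<phi>(y)) g(x,y) + b \<Sum> f\<close>, summed over grid arcs. The flow \<open>g\<close>
  restricted to the grid has the divergence of \<open>f\<close> except for a flow \<open>z\<close> missing between \<open>u\<close> and \<open>v\<close>.
  Summation by parts therefore turns the right-hand side into \<open>C_old - z (\<phi>(u) - \<phi>(v))\<close>.\<close>

section \<open>Feasible flows and user equilibria\<close>

lemma (in pre_digraph) cas_sum_potential_diff:
  "cas x p y \<Longrightarrow> (\<Sum>e\<leftarrow>p. \<phi> (tail G e) - \<phi> (head G e)) = (\<phi> x - \<phi> y :: real)"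
  by (induction p arbitrary: x) auto

lemma (in pre_digraph) apath_distinct_arcs: "apath x p y \<Longrightarrow> distinct p"
  by (auto simp: apath_def awalk_verts_conv distinct_map split: if_splits)

context fin_digraph
begin

text \<open>Summation by parts on a digraph: grouping the arcs once by tail and once by head charges
  every arc with the potential at its two ends.\<close>

lemma sum_divergence_potential:
  fixes \<phi> :: "'a \<Rightarrow> real"
  shows "(\<Sum>w\<in>verts G. \<phi> w * (sum f (out_arcs G w) - sum f (in_arcs G w))) =
         (\<Sum>e\<in>arcs G. f e * (\<phi> (tail G e) - \<phi> (head G e)))"
proof -
  have "(\<Sum>w\<in>verts G. \<phi> w * sum f (out_arcs G w)) = (\<Sum>e\<in>arcs G. f e * \<phi> (tail G e))"
  proof -
    have "(\<Sum>w\<in>verts G. \<phi> w * sum f (out_arcs G w)) =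
          (\<Sum>w\<in>verts G. \<Sum>e\<in>{e\<in>arcs G. tail G e = w}. f e * \<phi> (tail G e))"
      by (intro sum.cong refl) (auto simp: out_arcs_def sum_distrib_left mult.commute)
    also have "\<dots> = (\<Sum>e\<in>arcs G. f e * \<phi> (tail G e))"
      by (rule sum.group) auto
    finally show ?thesis .
  qed
  moreover have "(\<Sum>w\<in>verts G. \<phi> w * sum f (in_arcs G w)) = (\<Sum>e\<in>arcs G. f e * \<phi> (head G e))"
  proof -
    have "(\<Sum>w\<in>verts G. \<phi> w * sum f (in_arcs G w)) =
          (\<Sum>w\<in>verts G. \<Sum>e\<in>{e\<in>arcs G. head G e = w}. f e * \<phi> (head G e))"
      by (intro sum.cong refl) (auto simp: in_arcs_def sum_distrib_left mult.commute)
    also have "\<dots> = (\<Sum>e\<in>arcs G. f e * \<phi> (head G e))"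
      by (rule sum.group) auto
    finally show ?thesis .
  qed
  ultimately show ?thesis
    by (simp add: right_diff_distrib sum_subtractf)
qed

text \<open>Conservation leaves only the terms at \<open>s\<close> and \<open>t\<close>. The
  potential is arbitrary: an indicator, negated distances, negated grid levels and the electrical
  potential each extract a different identity later.\<close>

lemma feasible_flow_potential:
  fixes \<phi> :: "'a \<Rightarrow> real"
  assumes "feasible_flow G s t q f" "s \<in> verts G" "t \<in> verts G" "s \<noteq> t"
  shows "(\<Sum>e\<in>arcs G. f e * (\<phi> (tail G e) - \<phi> (head G e))) = q * (\<phi> s - \<phi> t)"
proof -
  let ?D = "\<lambda>w. \<phi> w * (sum f (out_arcs G w) - sum f (in_arcs G w))"
  have "(\<Sum>w\<in>verts G. ?D w) = (\<Sum>w\<in>{s, t}. ?D w)"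
    using assms by (intro sum.mono_neutral_right) (auto simp: feasible_flow_def)
  also have "\<dots> = q * (\<phi> s - \<phi> t)"
  proof -
    have "sum f (out_arcs G s) - sum f (in_arcs G s) = q"
         "sum f (out_arcs G t) - sum f (in_arcs G t) = - q"
      using assms by (auto simp: feasible_flow_def)
    moreover have "(\<Sum>w\<in>{s, t}. ?D w) = ?D s + ?D t"
      using assms by simp
    ultimately show ?thesis by (simp only:) (simp add: algebra_simps)
  qed
  finally show ?thesis by (simp add: sum_divergence_potential)
qed

section \<open>Path decompositions and the variational inequality\<close>

lemma finite_st_paths: "finite (st_paths G s t)"
  unfolding st_paths_def by (rule apaths_finite)

text \<open>Exchange of the sums over arcs and over paths; a path repeats no arc, so summing over
  its list is summing over its set of arcs.\<close>

lemma path_decomposition_sum: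
  fixes k :: "'b \<Rightarrow> real"
  assumes "\<forall>e\<in>arcs G. f e = (\<Sum>p\<in>{p \<in> st_paths G s t. e \<in> set p}. h p)"
  shows "(\<Sum>e\<in>arcs G. f e * k e) = (\<Sum>p\<in>st_paths G s t. h p * (\<Sum>e\<leftarrow>p. k e))"
proof -
  have "(\<Sum>e\<in>arcs G. f e * k e) =
        (\<Sum>e\<in>arcs G. \<Sum>p\<in>{p \<in> st_paths G s t. e \<in> set p}. h p * k e)"
    using assms by (simp add: sum_distrib_right)
  also have "\<dots> = (\<Sum>p\<in>st_paths G s t. \<Sum>e\<in>{e \<in> arcs G. e \<in> set p}. h p * k e)"
    by (rule sum.swap_restrict) (simp_all add: finite_st_paths)
  also have "\<dots> = (\<Sum>p\<in>st_paths G s t. h p * (\<Sum>e\<leftarrow>p. k e))"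
  proof (rule sum.cong[OF refl])
    fix p assume "p \<in> st_paths G s t"
    then have p: "apath s p t" by (simp add: st_paths_def)
    then have "{e \<in> arcs G. e \<in> set p} = set p"
      by (auto simp: apath_def awalk_def)
    then show "(\<Sum>e\<in>{e \<in> arcs G. e \<in> set p}. h p * k e) = h p * (\<Sum>e\<leftarrow>p. k e)"
      using apath_distinct_arcs[OF p]
      by (simp add: sum_list_distinct_conv_sum_set sum_distrib_left)
  qed
  finally show ?thesis .
qed

text \<open>The paths carrying flow all have minimal latency and so share one value
  \<open>l\<close>; the path flows add up to \<open>q\<close>, and \<open>q > 0\<close> ensures that
  some path carries flow.\<close>

lemma user_equilibrium_cost:
  assumes ue: "user_equilibrium G lat s t q f"
    and st: "s \<in> verts G" "t \<in> verts G" "s \<noteq> t" and q: "q > 0"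
  obtains l where "total_travel_time G lat f = q * l"
    and "\<And>p. p \<in> st_paths G s t \<Longrightarrow> l \<le> path_latency lat f p"
proof -
  let ?P = "st_paths G s t"
  obtain h where h0: "\<forall>p\<in>?P. 0 \<le> h p"
    and fh: "\<forall>e\<in>arcs G. f e = (\<Sum>p\<in>{p \<in> ?P. e \<in> set p}. h p)"
    and best: "\<And>p p'. p \<in> ?P \<Longrightarrow> 0 < h p \<Longrightarrow> p' \<in> ?P \<Longrightarrow>
      path_latency lat f p \<le> path_latency lat f p'"
    and ff: "feasible_flow G s t q f"
    using ue unfolding user_equilibrium_def by blast
  have total: "(\<Sum>p\<in>?P. h p) = q"
  proof -
    \<comment> \<open>The indicator of \<open>s\<close> drops by 1 along every path from
      \<open>s\<close> to \<open>t\<close>, so pairing it with \<open>f\<close> gives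
      \<open>q\<close> by conservation and the sum of the path flows by the decomposition.\<close>
    define \<phi> :: "'a \<Rightarrow> real" where "\<phi> w = (if w = s then 1 else 0)" for w
    have "q = (\<Sum>e\<in>arcs G. f e * (\<phi> (tail G e) - \<phi> (head G e)))"
      using feasible_flow_potential[OF ff st, of \<phi>] st by (simp add: \<phi>_def)
    also have "\<dots> = (\<Sum>p\<in>?P. h p * (\<Sum>e\<leftarrow>p. \<phi> (tail G e) - \<phi> (head G e)))"
      by (rule path_decomposition_sum[OF fh])
    also have "\<dots> = (\<Sum>p\<in>?P. h p)"
    proof (rule sum.cong[OF refl])
      fix p assume "p \<in> ?P"
      then have "cas s p t" by (simp add: st_paths_def apath_def awalk_def)
      then show "h p * (\<Sum>e\<leftarrow>p. \<phi> (tail G e) - \<phi> (head G e)) = h p"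
        using st cas_sum_potential_diff[of s p t \<phi>] by (simp add: \<phi>_def)
    qed
    finally show ?thesis by simp
  qed
  then obtain p0 where p0: "p0 \<in> ?P" "0 < h p0"
    using q sum_nonpos[of ?P h] by force
  have "total_travel_time G lat f = (\<Sum>p\<in>?P. h p * path_latency lat f p)"
    unfolding total_travel_time_def path_latency_def by (rule path_decomposition_sum[OF fh])
  also have "\<dots> = (\<Sum>p\<in>?P. h p * path_latency lat f p0)"
  proof (rule sum.cong[OF refl])
    fix p assume p: "p \<in> ?P"
    show "h p * path_latency lat f p = h p * path_latency lat f p0"
      using h0 p best[OF p _ p0(1)] best[OF p0 p] by (cases "h p = 0") force+
  qed
  also have "\<dots> = q * path_latency lat f p0"
    by (simp add: total flip: sum_distrib_right)
  finally show ?thesis using that best[OF p0] by blast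
qed

text \<open>Testing the flow \<open>g\<close> against the shortest-path distances from \<open>s\<close> makes a path decomposition
  of \<open>g\<close> unnecessary.\<close>

lemma user_equilibrium_variational:
  assumes ue: "user_equilibrium G lat s t q f" and g: "feasible_flow G s t q g"
    and st: "s \<in> verts G" "t \<in> verts G" "s \<noteq> t" and q: "q > 0"
    and reach: "\<And>w. w \<in> verts G \<Longrightarrow> s \<rightarrow>\<^sup>* w"
    and lat_nonneg: "\<And>e. e \<in> arcs G \<Longrightarrow> 0 \<le> lat e (f e)"
  shows "total_travel_time G lat f \<le> (\<Sum>e\<in>arcs G. g e * lat e (f e))"
proof -
  obtain l where l: "total_travel_time G lat f = q * l"
    and l_le: "\<And>p. p \<in> st_paths G s t \<Longrightarrow> l \<le> path_latency lat f p"
    using user_equilibrium_cost[OF ue st q] by blast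
  define k where "k e = lat e (f e)" for e
  define \<pi> where "\<pi> w = real_of_ereal (\<mu> k s w)" for w
  have path: "\<exists>p. apath s p w \<and> \<mu> k s w = awalk_cost k p" if "w \<in> verts G" for w
    using min_cost_awalk[OF reach[OF that], of k] lat_nonneg by (simp add: k_def)
  \<comment> \<open>Distances are attained by paths, hence finite.\<close>
  have \<pi>: "\<mu> k s w = ereal (\<pi> w)" if "w \<in> verts G" for w
    using path[OF that] by (auto simp: \<pi>_def)
  have "\<mu> k s s \<le> awalk_cost k []"
    using st by (intro min_cost_le_walk_cost) (simp add: awalk_Nil_iff)
  then have \<pi>s: "\<pi> s \<le> 0" using \<pi>[OF st(1)] by simp
  have "path_latency lat f p = awalk_cost k p" for p
    by (simp add: path_latency_def awalk_cost_def k_def[abs_def])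
  then have \<pi>t: "l \<le> \<pi> t"
    using path[OF st(2)] \<pi>[OF st(2)] l_le by (auto simp: st_paths_def)
  \<comment> \<open>The potential tested is \<open>- \<pi>\<close>: it drops by at least
    \<open>l\<close> from \<open>s\<close> to \<open>t\<close>, and by at most the latency along
    each arc, by the triangle inequality for distances.\<close>
  have "q * l \<le> q * (- \<pi> s - - \<pi> t)"
    using q \<pi>s \<pi>t by (intro mult_left_mono) auto
  also have "\<dots> = (\<Sum>e\<in>arcs G. g e * (- \<pi> (tail G e) - - \<pi> (head G e)))"
    by (rule feasible_flow_potential[OF g st, symmetric])
  also have "\<dots> \<le> (\<Sum>e\<in>arcs G. g e * k e)"
  proof (intro sum_mono mult_left_mono)
    fix e assume e: "e \<in> arcs G"
    have "\<mu> k s (head G e) \<le> \<mu> k s (tail G e) + k e"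
      using e lat_nonneg
      by (intro pos_cost_mu_triangle) (auto simp: arc_to_ends_def k_def)
    then show "- \<pi> (tail G e) - - \<pi> (head G e) \<le> k e"
      using e by (simp add: \<pi>)
    show "0 \<le> g e" using g e by (simp add: feasible_flow_def)
  qed
  finally show ?thesis by (simp add: l k_def)
qed

end

section \<open>Pseudoinverses\<close>

text \<open>Elimination of one unknown at a time: a principal submatrix of a positive definite
  matrix is again positive definite, as extending a vector by 0 shows.\<close>

lemma positive_definite_solvable:
  fixes A :: "'i \<Rightarrow> 'i \<Rightarrow> real"
  assumes "finite I"
    and "\<And>x. \<exists>i\<in>I. x i \<noteq> 0 \<Longrightarrow> 0 < (\<Sum>i\<in>I. \<Sum>j\<in>I. x i * A i j * x j)"
  shows "\<exists>x. \<forall>i\<in>I. (\<Sum>j\<in>I. A i j * x j) = b i"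
  using assms
proof (induction I arbitrary: b rule: finite_induct)
  case empty
  then show ?case by simp
next
  case (insert k I)
  have pd: "0 < (\<Sum>i\<in>I. \<Sum>j\<in>I. x i * A i j * x j)" if ex: "\<exists>i\<in>I. x i \<noteq> 0" for x
  proof -
    have ne: "i \<noteq> k" if "i \<in> I" for i using insert.hyps that by blast
    have "\<exists>i\<in>insert k I. (x(k := 0)) i \<noteq> 0" using ex ne by auto
    from insert.prems[OF this] show ?thesis
      using insert.hyps ne by (simp cong: sum.cong)
  qed
  have IH: "\<exists>x. \<forall>i\<in>I. (\<Sum>j\<in>I. A i j * x j) = b i" for b
    using insert.IH pd by blast
  \<comment> \<open>\<open>A w\<close> vanishes on \<open>I\<close>, so adding multiples of \<open>w\<close> only affects the equation
    with index \<open>k\<close>.\<close>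
  obtain w0 where w0: "\<forall>i\<in>I. (\<Sum>j\<in>I. A i j * w0 j) = - A i k"
    using IH[of "\<lambda>i. - A i k"] by blast
  define w where "w = w0(k := 1)"
  have wI: "(\<Sum>j\<in>insert k I. A i j * w j) = A i k + (\<Sum>j\<in>I. A i j * w0 j)" for i
    using insert.hyps by (auto simp: w_def intro!: sum.cong)
  have w_zero: "(\<Sum>j\<in>insert k I. A i j * w j) = 0" if "i \<in> I" for i
    using w0 that by (simp add: wI)
  \<comment> \<open>The Schur complement of the block \<open>I\<close>. It equals the quadratic form
    of \<open>A\<close> at \<open>w\<close>, hence is positive and can be divided by.\<close>
  define \<sigma> where "\<sigma> = (\<Sum>j\<in>insert k I. A k j * w j)"
  have "0 < (\<Sum>i\<in>insert k I. \<Sum>j\<in>insert k I. w i * A i j * w j)"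
    by (rule insert.prems) (simp add: w_def)
  also have "\<dots> = (\<Sum>i\<in>insert k I. w i * (\<Sum>j\<in>insert k I. A i j * w j))"
    by (simp only: sum_distrib_left mult.assoc)
  also have "\<dots> = w k * \<sigma> + (\<Sum>i\<in>I. w i * (\<Sum>j\<in>insert k I. A i j * w j))"
    unfolding \<sigma>_def using insert.hyps by (intro sum.insert) auto
  also have "\<dots> = \<sigma>"
    using w_zero by (simp add: w_def)
  finally have \<sigma>: "\<sigma> > 0" .
  obtain x0 where x0: "\<forall>i\<in>I. (\<Sum>j\<in>I. A i j * x0 j) = b i"
    using IH by blast
  define x1 where "x1 = x0(k := 0)"
  have x1: "(\<Sum>j\<in>insert k I. A i j * x1 j) = (\<Sum>j\<in>I. A i j * x0 j)" for i
    using insert.hyps by (auto simp: x1_def intro!: sum.cong)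
  define \<tau> where "\<tau> = (b k - (\<Sum>j\<in>I. A k j * x0 j)) / \<sigma>"
  have "(\<Sum>j\<in>insert k I. A i j * (x1 j + \<tau> * w j)) = b i" if "i \<in> insert k I" for i
  proof -
    have "(\<Sum>j\<in>insert k I. A i j * (x1 j + \<tau> * w j)) =
          (\<Sum>j\<in>insert k I. A i j * x1 j) + \<tau> * (\<Sum>j\<in>insert k I. A i j * w j)"
      unfolding sum_distrib_left by (subst sum.distrib[symmetric]) (simp add: algebra_simps)
    also have "\<dots> = b i"
      using that \<sigma> x0 w_zero by (cases "i = k") (auto simp: x1 \<tau>_def simp flip: \<sigma>_def)
    finally show ?thesis .
  qed
  then show ?case by (intro exI[of _ "\<lambda>j. x1 j + \<tau> * w j"] ballI)
qed

section \<open>Uniqueness of the Moore-Penrose pseudoinverse\<close>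

lemma mat_prod_assoc:
  assumes "finite I"
  shows "mat_prod I (mat_prod I A B) C = mat_prod I A (mat_prod I B C)"
proof (intro ext)
  fix x y
  have "(\<Sum>k\<in>I. (\<Sum>l\<in>I. A x l * B l k) * C k y) = (\<Sum>k\<in>I. \<Sum>l\<in>I. A x l * B l k * C k y)"
    by (simp add: sum_distrib_right)
  also have "\<dots> = (\<Sum>l\<in>I. \<Sum>k\<in>I. A x l * B l k * C k y)"
    by (rule sum.swap)
  also have "\<dots> = (\<Sum>l\<in>I. A x l * (\<Sum>k\<in>I. B l k * C k y))"
    by (simp add: sum_distrib_left mult.assoc)
  finally show "mat_prod I (mat_prod I A B) C x y = mat_prod I A (mat_prod I B C) x y"
    by (simp add: mat_prod_def)
qed

lemma mat_prod_cong:
  "mat_eq_on I A A' \<Longrightarrow> mat_eq_on I B B' \<Longrightarrow> mat_eq_on I (mat_prod I A B) (mat_prod I A' B')"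
  by (simp add: mat_eq_on_def mat_prod_def)

lemma mat_transp_prod: "mat_transp (mat_prod I A B) = mat_prod I (mat_transp B) (mat_transp A)"
  by (simp add: fun_eq_iff mat_transp_def mat_prod_def mult.commute)

lemma mat_eq_on_refl: "mat_eq_on I A A"
  and mat_eq_on_sym: "mat_eq_on I A B \<Longrightarrow> mat_eq_on I B A"
  by (simp_all add: mat_eq_on_def)

text \<open>Transposing \<open>Q P = R\<close> reverses the factors and changes none of the three
  matrices.\<close>

lemma symmetric_prod_commute:
  assumes "mat_eq_on I (mat_transp P) P" "mat_eq_on I (mat_transp Q) Q" "mat_eq_on I (mat_transp R) R"
    and "mat_eq_on I (mat_prod I Q P) R"
  shows "mat_eq_on I (mat_prod I P Q) R"
proof -
  have "mat_eq_on I (mat_prod I P Q) (mat_prod I (mat_transp P) (mat_transp Q))"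
    by (intro mat_prod_cong assms(1,2)[THEN mat_eq_on_sym])
  also have "mat_prod I (mat_transp P) (mat_transp Q) = mat_transp (mat_prod I Q P)"
    by (simp add: mat_transp_prod)
  finally show ?thesis
    using assms(3,4) by (simp add: mat_eq_on_def mat_transp_def)
qed

text \<open>Penrose's argument: by symmetry the product of \<open>A X\<close> and \<open>A Y\<close>
  equals each of them, so \<open>A X = A Y\<close>, and likewise \<open>X A = Y A\<close>. Then
  \<open>X = X A X = X A Y = Y A Y = Y\<close> on \<open>I\<close>; outside, both are 0 by
  convention.\<close>

lemma is_pseudoinverse_unique:
  assumes I: "finite I" and X: "is_pseudoinverse I A X" and Y: "is_pseudoinverse I A Y"
  shows "X = Y"
proof -
  note assoc = mat_prod_assoc[OF I]
  have AX_AY: "mat_eq_on I (mat_prod I (mat_prod I A X) (mat_prod I A Y)) (mat_prod I A Y)"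
    if "is_pseudoinverse I A X" for X Y
  proof -
    have "mat_eq_on I (mat_prod I (mat_prod I (mat_prod I A X) A) Y) (mat_prod I A Y)"
      using that by (intro mat_prod_cong mat_eq_on_refl) (simp add: is_pseudoinverse_def)
    then show ?thesis by (simp add: assoc)
  qed
  have XA_YA: "mat_eq_on I (mat_prod I (mat_prod I X A) (mat_prod I Y A)) (mat_prod I X A)"
    if "is_pseudoinverse I A Y" for X Y
  proof -
    have "mat_eq_on I (mat_prod I X (mat_prod I (mat_prod I A Y) A)) (mat_prod I X A)"
      using that by (intro mat_prod_cong mat_eq_on_refl) (simp add: is_pseudoinverse_def)
    then show ?thesis by (simp add: assoc)
  qed
  have sym: "mat_eq_on I (mat_transp (mat_prod I A Z)) (mat_prod I A Z)"
    "mat_eq_on I (mat_transp (mat_prod I Z A)) (mat_prod I Z A)" if "is_pseudoinverse I A Z" for Z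
    using that by (simp_all add: is_pseudoinverse_def)
  have 1: "mat_eq_on I (mat_prod I A X) (mat_prod I A Y)"
    using AX_AY[OF X, of Y]
      symmetric_prod_commute[OF sym(1)[OF X] sym(1)[OF Y] sym(1)[OF X] AX_AY[OF Y]]
    by (simp add: mat_eq_on_def)
  have 2: "mat_eq_on I (mat_prod I Y A) (mat_prod I X A)"
    using XA_YA[OF X, of Y]
      symmetric_prod_commute[OF sym(2)[OF Y] sym(2)[OF X] sym(2)[OF X] XA_YA[OF Y]]
    by (simp add: mat_eq_on_def)
  have X': "mat_eq_on I (mat_prod I (mat_prod I X A) X) X"
    and Y': "mat_eq_on I (mat_prod I (mat_prod I Y A) Y) Y"
    using X Y by (simp_all add: is_pseudoinverse_def)
  have "mat_eq_on I (mat_prod I (mat_prod I Y A) Y) (mat_prod I (mat_prod I X A) Y)"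
    by (intro mat_prod_cong 2 mat_eq_on_refl)
  also have "mat_prod I (mat_prod I X A) Y = mat_prod I X (mat_prod I A Y)"
    by (rule assoc)
  finally have "mat_eq_on I (mat_prod I (mat_prod I Y A) Y) (mat_prod I X (mat_prod I A Y))" .
  moreover have "mat_eq_on I (mat_prod I X (mat_prod I A X)) (mat_prod I X (mat_prod I A Y))"
    by (intro mat_prod_cong 1 mat_eq_on_refl)
  ultimately have "mat_eq_on I X Y"
    using X' Y' unfolding assoc by (simp add: mat_eq_on_def)
  moreover have "X x y = 0" "Y x y = 0" if "x \<notin> I \<or> y \<notin> I" for x y
    using X Y that by (simp_all add: is_pseudoinverse_def)
  ultimately have "X x y = Y x y" for x y
    by (cases "x \<in> I \<and> y \<in> I") (auto simp: mat_eq_on_def)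
  then show ?thesis by (intro ext)
qed

lemma pseudoinverse_eqI:
  "finite I \<Longrightarrow> is_pseudoinverse I A X \<Longrightarrow> pseudoinverse I A = X"
  unfolding pseudoinverse_def by (rule the_equality) (assumption, rule is_pseudoinverse_unique)

section \<open>Laplacians\<close>

text \<open>Asymmetry excludes loops and antiparallel arcs, so that arcs correspond to undirected
  edges. Reachability from the root gives connectedness, which reduces the kernel of the Laplacian
  to the constants.\<close>

locale rooted_network = pair_fin_digraph G for G :: "'v pair_pre_digraph" +
  fixes r :: 'v and a :: real
  assumes asym: "(x, y) \<in> parcs G \<Longrightarrow> (y, x) \<notin> parcs G"
    and root: "r \<in> pverts G"
    and reachable_root: "x \<in> pverts G \<Longrightarrow> r \<rightarrow>\<^sup>*\<^bsub>G\<^esub> x"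
    and a_pos: "a > 0"
begin

text \<open>Ohm's law; a negative value is a current against the direction of the arc.\<close>

definition current :: "('v \<Rightarrow> real) \<Rightarrow> 'v \<times> 'v \<Rightarrow> real" where
  "current \<phi> e = (\<phi> (fst e) - \<phi> (snd e)) / a"

text \<open>Kirchhoff's view of the Laplacian as net current. The neighbours of \<open>x\<close> are
  the heads of outgoing and the tails of incoming arcs, two sets that asymmetry makes
  disjoint.\<close>

lemma laplacian_apply:
  assumes x: "x \<in> pverts G"
  shows "(\<Sum>y\<in>pverts G. laplacian G a x y * \<phi> y) =
         sum (current \<phi>) (out_arcs G x) - sum (current \<phi>) (in_arcs G x)"
proof -
  define N where "N = {w. (x, w) \<in> parcs (mk_symmetric G)}"
  have N: "N = snd ` out_arcs G x \<union> fst ` in_arcs G x"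
    by (force simp: N_def parcs_mk_symmetric out_arcs_def in_arcs_def)
  have finN: "finite N"
    unfolding N by (simp add: finite_out_arcs finite_in_arcs)
  have NV: "N \<subseteq> pverts G - {x}"
    using asym wellformed' by (fastforce simp: N out_arcs_def in_arcs_def)
  have "(\<Sum>y\<in>pverts G. laplacian G a x y * \<phi> y) =
        laplacian G a x x * \<phi> x + (\<Sum>y\<in>pverts G - {x}. laplacian G a x y * \<phi> y)"
    using x by (simp add: sum.remove pair_finite_verts)
  also have "(\<Sum>y\<in>pverts G - {x}. laplacian G a x y * \<phi> y) = (\<Sum>y\<in>N. - (\<phi> y / a))"
    using NV by (intro sum.mono_neutral_cong_right)
      (auto simp: pair_finite_verts laplacian_def N_def)
  also have "laplacian G a x x * \<phi> x = (\<Sum>y\<in>N. \<phi> x / a)"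
    by (simp add: laplacian_def N_def)
  also have "(\<Sum>y\<in>N. \<phi> x / a) + (\<Sum>y\<in>N. - (\<phi> y / a)) = (\<Sum>y\<in>N. (\<phi> x - \<phi> y) / a)"
    by (subst sum.distrib[symmetric]) (simp add: diff_divide_distrib)
  also have "\<dots> = (\<Sum>y\<in>snd ` out_arcs G x. (\<phi> x - \<phi> y) / a) +
                     (\<Sum>y\<in>fst ` in_arcs G x. (\<phi> x - \<phi> y) / a)"
    unfolding N using asym
    by (intro sum.union_disjoint) (auto simp: finite_out_arcs finite_in_arcs out_arcs_def in_arcs_def)
  also have "(\<Sum>y\<in>snd ` out_arcs G x. (\<phi> x - \<phi> y) / a) = sum (current \<phi>) (out_arcs G x)"
    by (subst sum.reindex) (auto simp: inj_on_def out_arcs_def current_def intro!: sum.cong)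
  also have "(\<Sum>y\<in>fst ` in_arcs G x. (\<phi> x - \<phi> y) / a) = - sum (current \<phi>) (in_arcs G x)"
    by (subst sum.reindex)
      (auto simp: inj_on_def in_arcs_def current_def diff_divide_distrib simp flip: sum_negf
        intro!: sum.cong)
  finally show ?thesis by simp
qed

lemma laplacian_symmetric: "laplacian G a x y = laplacian G a y x"
  by (auto simp: laplacian_def parcs_mk_symmetric)

text \<open>Summation by parts turns the quadratic form into the Dirichlet energy, a sum of squares
  from which semidefiniteness and the kernel are read off.\<close>

lemma laplacian_energy:
  "(\<Sum>x\<in>pverts G. \<phi> x * (\<Sum>y\<in>pverts G. laplacian G a x y * \<phi> y)) =
   (\<Sum>e\<in>parcs G. (\<phi> (fst e) - \<phi> (snd e))\<^sup>2 / a)"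
  using sum_divergence_potential[of \<phi> "current \<phi>"]
  by (simp add: laplacian_apply current_def power2_eq_square cong: sum.cong)

lemma eq_on_arcs_imp_constant:
  assumes "\<And>x y. (x, y) \<in> parcs G \<Longrightarrow> \<phi> x = \<phi> y" and "x \<in> pverts G"
  shows "\<phi> x = \<phi> r"
proof -
  have "\<phi> w = \<phi> y" if "awalk w p y" for w p y
    using that by (induction p arbitrary: w) (auto simp: awalk_simps assms(1))
  then show ?thesis
    using reachable_root[OF assms(2)] by (metis reachable_awalk)
qed

lemma energy_zero_imp_constant:
  assumes "(\<Sum>x\<in>pverts G. \<phi> x * (\<Sum>y\<in>pverts G. laplacian G a x y * \<phi> y)) = 0"
    and "x \<in> pverts G"
  shows "\<phi> x = \<phi> r"
proof (rule eq_on_arcs_imp_constant[OF _ assms(2)])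
  fix y z assume "(y, z) \<in> parcs G"
  moreover have "\<forall>e\<in>parcs G. (\<phi> (fst e) - \<phi> (snd e))\<^sup>2 / a = 0"
    using assms(1) a_pos unfolding laplacian_energy
    by (subst (asm) sum_nonneg_eq_0_iff) (auto simp: pair_finite_arcs)
  ultimately show "\<phi> y = \<phi> z" using a_pos by force
qed

lemma laplacian_kernel:
  assumes "\<And>x. x \<in> pverts G \<Longrightarrow> (\<Sum>y\<in>pverts G. laplacian G a x y * \<phi> y) = 0"
    and "x \<in> pverts G"
  shows "\<phi> x = \<phi> r"
  by (rule energy_zero_imp_constant[OF _ assms(2)]) (simp add: assms(1))

lemma laplacian_sum_zero:
  assumes "x \<in> pverts G"
  shows "(\<Sum>y\<in>pverts G. laplacian G a x y) = 0"
    and "(\<Sum>y\<in>pverts G. laplacian G a y x) = 0"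
  using laplacian_apply[OF assms, of "\<lambda>_. 1"]
  by (simp_all add: current_def laplacian_symmetric[of _ x])

text \<open>Adding the all-ones matrix makes the Laplacian positive definite without changing its action
  on vectors with coordinate sum 0.\<close>

lemma laplacian_solvable:
  assumes "(\<Sum>x\<in>pverts G. b x) = 0"
  obtains \<phi> where "\<And>x. x \<in> pverts G \<Longrightarrow> (\<Sum>y\<in>pverts G. laplacian G a x y * \<phi> y) = b x"
    and "(\<Sum>x\<in>pverts G. \<phi> x) = 0"
proof -
  let ?L = "laplacian G a" and ?V = "pverts G"
  have split: "(\<Sum>y\<in>?V. (?L x y + 1) * \<phi> y) = (\<Sum>y\<in>?V. ?L x y * \<phi> y) + (\<Sum>y\<in>?V. \<phi> y)" for x \<phi>
    by (simp add: algebra_simps sum.distrib)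
  have pd: "0 < (\<Sum>x\<in>?V. \<Sum>y\<in>?V. \<phi> x * (?L x y + 1) * \<phi> y)" if "\<exists>x\<in>?V. \<phi> x \<noteq> 0" for \<phi>
  proof -
    let ?E = "\<Sum>x\<in>?V. \<phi> x * (\<Sum>y\<in>?V. ?L x y * \<phi> y)"
    have "(\<Sum>x\<in>?V. \<Sum>y\<in>?V. \<phi> x * (?L x y + 1) * \<phi> y) = (\<Sum>x\<in>?V. \<phi> x * (\<Sum>y\<in>?V. (?L x y + 1) * \<phi> y))"
      by (simp add: sum_distrib_left mult.assoc)
    also have "\<dots> = ?E + (\<Sum>x\<in>?V. \<phi> x)\<^sup>2"
      by (simp add: split distrib_left sum.distrib power2_eq_square flip: sum_distrib_right)
    finally have eq: "(\<Sum>x\<in>?V. \<Sum>y\<in>?V. \<phi> x * (?L x y + 1) * \<phi> y) = ?E + (\<Sum>x\<in>?V. \<phi> x)\<^sup>2" .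
    have E: "?E \<ge> 0"
      unfolding laplacian_energy using a_pos by (intro sum_nonneg) simp
    \<comment> \<open>If both vanished, \<open>\<phi>\<close> would be constant with coordinate sum
      0, hence 0.\<close>
    have "?E \<noteq> 0 \<or> (\<Sum>x\<in>?V. \<phi> x) \<noteq> 0"
    proof (rule ccontr)
      assume "\<not> ?thesis"
      then have "?E = 0" and z: "(\<Sum>x\<in>?V. \<phi> x) = 0" by auto
      then have const: "\<phi> x = \<phi> r" if "x \<in> ?V" for x
        using energy_zero_imp_constant that by blast
      then have "(\<Sum>x\<in>?V. \<phi> x) = real (card ?V) * \<phi> r"
        by simp
      then have "\<phi> r = 0"
        using z root pair_finite_verts by auto
      then show False using that const by auto
    qed
    then show ?thesis unfolding eq
    proof
      assume "?E \<noteq> 0"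
      with E have "?E > 0" by (rule le_neq_trans[OF _ not_sym])
      then show "0 < ?E + (\<Sum>x\<in>?V. \<phi> x)\<^sup>2" by (rule add_pos_nonneg) simp
    next
      assume "(\<Sum>x\<in>?V. \<phi> x) \<noteq> 0"
      then show "0 < ?E + (\<Sum>x\<in>?V. \<phi> x)\<^sup>2" by (intro add_nonneg_pos E) simp
    qed
  qed
  obtain \<phi> where \<phi>: "\<forall>x\<in>?V. (\<Sum>y\<in>?V. (?L x y + 1) * \<phi> y) = b x"
    using positive_definite_solvable[OF pair_finite_verts pd] by blast
  \<comment> \<open>The equations are added up: the columns of the Laplacian sum to 0, so only a
    multiple of the coordinate sum of \<open>\<phi>\<close> survives.\<close>
  have "0 = (\<Sum>x\<in>?V. \<Sum>y\<in>?V. (?L x y + 1) * \<phi> y)"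
    using assms \<phi> by simp
  also have "\<dots> = (\<Sum>x\<in>?V. \<Sum>y\<in>?V. ?L x y * \<phi> y) + real (card ?V) * (\<Sum>y\<in>?V. \<phi> y)"
    by (simp add: split sum.distrib)
  also have "(\<Sum>x\<in>?V. \<Sum>y\<in>?V. ?L x y * \<phi> y) = (\<Sum>y\<in>?V. \<Sum>x\<in>?V. ?L x y * \<phi> y)"
    by (rule sum.swap)
  also have "\<dots> = 0"
    by (simp add: laplacian_sum_zero flip: sum_distrib_right)
  finally have "(\<Sum>y\<in>?V. \<phi> y) = 0"
    using root pair_finite_verts by auto
  with \<phi> show ?thesis by (intro that[of \<phi>]) (simp_all add: split)
qed

section \<open>The pseudoinverse of the Laplacian and electrical potentials\<close>

text \<open>Column \<open>y\<close> of the pseudoinverse is the solution with coordinate sum 0 for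
  the right-hand side \<open>P e_y\<close>, where \<open>P\<close> projects orthogonally onto the
  vectors of coordinate sum 0. Existence and uniqueness together give meaning to the definite
  description.\<close>

lemma laplacian_pseudoinverse:
  "is_pseudoinverse (pverts G) (laplacian G a) (pseudoinverse (pverts G) (laplacian G a))"
proof -
  let ?L = "laplacian G a" and ?V = "pverts G"
  define N where "N = real (card ?V)"
  have N: "N > 0" using root pair_finite_verts by (auto simp: N_def card_gt_0_iff)
  define P where "P x y = (if x = y then 1 else 0) - 1 / N" for x y :: 'v
  have P_sum: "(\<Sum>x\<in>?V. P x y) = 0" "(\<Sum>x\<in>?V. P y x) = 0" if "y \<in> ?V" for y
    using that N pair_finite_verts by (auto simp: P_def sum_subtractf N_def)
  have "\<exists>\<phi>. (\<forall>x\<in>?V. (\<Sum>k\<in>?V. ?L x k * \<phi> k) = P x y) \<and> (\<Sum>x\<in>?V. \<phi> x) = 0" if "y \<in> ?V" for y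
    using laplacian_solvable[OF P_sum(1)[OF that]] by metis
  then obtain X0 where X0: "\<And>x y. x \<in> ?V \<Longrightarrow> y \<in> ?V \<Longrightarrow> (\<Sum>k\<in>?V. ?L x k * X0 y k) = P x y"
    and X0_sum: "\<And>y. y \<in> ?V \<Longrightarrow> (\<Sum>x\<in>?V. X0 y x) = 0"
    by metis
  define X where "X x y = (if x \<in> ?V \<and> y \<in> ?V then X0 y x else 0)" for x y
  have LX: "mat_eq_on ?V (mat_prod ?V ?L X) P"
    using X0 by (simp add: mat_eq_on_def mat_prod_def X_def)
  have X_sum: "(\<Sum>x\<in>?V. X x y) = 0" if "y \<in> ?V" for y
    using X0_sum that by (simp add: X_def)
  have PL: "mat_eq_on ?V (mat_prod ?V P ?L) ?L" and LP: "mat_eq_on ?V (mat_prod ?V ?L P) ?L"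
    and PX: "mat_eq_on ?V (mat_prod ?V P X) X"
    using pair_finite_verts X_sum laplacian_sum_zero
    by (simp_all add: mat_eq_on_def mat_prod_def P_def left_diff_distrib right_diff_distrib
        sum_subtractf if_distrib[of "\<lambda>c. c * _"] if_distrib[of "\<lambda>c. _ * c"] cong: if_cong
        flip: sum_divide_distrib)
  \<comment> \<open>The columns of \<open>X L - P\<close> lie in the kernel of \<open>L\<close>,
    because \<open>L X L = P L = L = L P\<close>. They are therefore constant, and having coordinate
    sum 0 they vanish.\<close>
  have XL: "mat_prod ?V X ?L x y = P x y" if x: "x \<in> ?V" and y: "y \<in> ?V" for x y
  proof -
    define \<psi> where "\<psi> k = mat_prod ?V X ?L k y - P k y" for k
    have "(\<Sum>k\<in>?V. ?L z k * \<psi> k) = 0" if z: "z \<in> ?V" for z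
    proof -
      have "(\<Sum>k\<in>?V. ?L z k * \<psi> k) =
            mat_prod ?V ?L (mat_prod ?V X ?L) z y - mat_prod ?V ?L P z y"
        by (simp add: \<psi>_def mat_prod_def right_diff_distrib sum_subtractf)
      also have "mat_prod ?V ?L (mat_prod ?V X ?L) z y = mat_prod ?V P ?L z y"
        using mat_prod_cong[OF LX mat_eq_on_refl, of ?L] y z
        by (simp add: mat_prod_assoc[OF pair_finite_verts] mat_eq_on_def)
      finally show ?thesis using PL LP y z by (simp add: mat_eq_on_def)
    qed
    then have const: "\<psi> k = \<psi> r" if "k \<in> ?V" for k
      using laplacian_kernel that by blast
    have "(\<Sum>k\<in>?V. mat_prod ?V X ?L k y) = (\<Sum>l\<in>?V. \<Sum>k\<in>?V. X k l * ?L l y)"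
      unfolding mat_prod_def by (rule sum.swap)
    also have "\<dots> = 0"
      using X_sum by (simp flip: sum_distrib_right)
    finally have "(\<Sum>k\<in>?V. \<psi> k) = 0"
      using P_sum y by (simp add: \<psi>_def sum_subtractf)
    then have "N * \<psi> r = 0"
      using const by (simp add: N_def)
    then show ?thesis using N const[OF x] by (simp add: \<psi>_def)
  qed
  then have XL: "mat_eq_on ?V (mat_prod ?V X ?L) P" by (simp add: mat_eq_on_def)
  have "mat_eq_on ?V (mat_prod ?V (mat_prod ?V ?L X) ?L) ?L"
    using mat_prod_cong[OF LX mat_eq_on_refl, of ?L] PL by (simp add: mat_eq_on_def)
  moreover have "mat_eq_on ?V (mat_prod ?V (mat_prod ?V X ?L) X) X"
    using mat_prod_cong[OF XL mat_eq_on_refl, of X] PX by (simp add: mat_eq_on_def)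
  ultimately have "is_pseudoinverse ?V ?L X"
    using LX XL by (simp add: is_pseudoinverse_def mat_eq_on_def mat_transp_def P_def X_def)
  then show ?thesis
    using pseudoinverse_eqI[OF pair_finite_verts] by metis
qed

text \<open>With \<open>Q = L^+ L\<close>, the identity \<open>L Q = L\<close> puts the columns of
  \<open>Q - I\<close> into the kernel, so they are constant; symmetry of \<open>Q\<close> makes all
  these constants equal. Pairing with \<open>w\<close>, of coordinate sum 0, removes them.\<close>

lemma pseudoinverse_potential:
  assumes w: "(\<Sum>x\<in>pverts G. w x) = 0" and x: "x \<in> pverts G"
  shows "(\<Sum>y\<in>pverts G. laplacian G a x y *
           (\<Sum>z\<in>pverts G. w z * pseudoinverse (pverts G) (laplacian G a) z y)) = w x"
proof -
  let ?L = "laplacian G a" and ?V = "pverts G"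
  let ?X = "pseudoinverse ?V ?L"
  note pinv = laplacian_pseudoinverse[unfolded is_pseudoinverse_def]
  define Q where "Q = mat_prod ?V ?X ?L"
  have Q_sym: "Q y z = Q z y" if "y \<in> ?V" "z \<in> ?V" for y z
    using pinv that by (simp add: Q_def mat_eq_on_def mat_transp_def)
  have LQ: "(\<Sum>k\<in>?V. ?L y k * Q k z) = ?L y z" if "y \<in> ?V" "z \<in> ?V" for y z
    using pinv that unfolding mat_prod_assoc[OF pair_finite_verts]
    by (simp add: Q_def mat_eq_on_def mat_prod_def)
  define \<psi> where "\<psi> z k = Q k z - (if k = z then 1 else 0)" for z k
  have \<psi>_root: "\<psi> z k = \<psi> z r" if "z \<in> ?V" "k \<in> ?V" for z k
    using that LQ pair_finite_verts
    by (intro laplacian_kernel)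
      (auto simp: \<psi>_def right_diff_distrib sum_subtractf if_distrib[of "\<lambda>c. _ * c"] cong: if_cong)
  have \<psi>_const: "\<psi> x k = \<psi> r r" if "k \<in> ?V" for k
  proof -
    have "\<psi> x k = \<psi> x r" by (rule \<psi>_root[OF x that])
    also have "\<dots> = \<psi> r x" using Q_sym x root by (auto simp: \<psi>_def)
    also have "\<dots> = \<psi> r r" by (rule \<psi>_root[OF root x])
    finally show ?thesis .
  qed
  have "(\<Sum>y\<in>?V. ?L x y * (\<Sum>z\<in>?V. w z * ?X z y)) = (\<Sum>y\<in>?V. \<Sum>z\<in>?V. w z * (?X z y * ?L y x))"
    by (simp add: sum_distrib_left mult_ac laplacian_symmetric[of x])
  also have "\<dots> = (\<Sum>z\<in>?V. \<Sum>y\<in>?V. w z * (?X z y * ?L y x))"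
    by (rule sum.swap)
  also have "\<dots> = (\<Sum>z\<in>?V. w z * Q z x)"
    by (simp add: Q_def mat_prod_def sum_distrib_left)
  also have "\<dots> = (\<Sum>z\<in>?V. (if z = x then w z else 0) + w z * \<psi> r r)"
  proof (rule sum.cong[OF refl])
    fix z assume "z \<in> ?V"
    then have "Q z x = (if z = x then 1 else 0) + \<psi> r r"
      using \<psi>_const[of z] by (simp add: \<psi>_def)
    then show "w z * Q z x = (if z = x then w z else 0) + w z * \<psi> r r"
      by (simp add: algebra_simps)
  qed
  also have "\<dots> = w x"
    using w x pair_finite_verts by (simp add: sum.distrib flip: sum_distrib_right)
  finally show ?thesis .
qed

text \<open>Identifies \<open>potential_diff\<close> as a voltage: the row vector
  \<open>q (e_s - e_t)^T L^+\<close> is the potential of the current fed in at \<open>s\<close> and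
  taken out at \<open>t\<close>.\<close>

lemma potential_diff_potential:
  assumes "s \<in> pverts G" "t \<in> pverts G" "u \<in> pverts G" "v \<in> pverts G"
  obtains \<phi> where
    "\<And>x. x \<in> pverts G \<Longrightarrow> sum (current \<phi>) (out_arcs G x) - sum (current \<phi>) (in_arcs G x) =
      q * (basis_vec s x - basis_vec t x)"
    and "potential_diff G a q s t u v = \<phi> u - \<phi> v"
proof
  let ?L = "laplacian G a" and ?V = "pverts G"
  let ?X = "pseudoinverse ?V ?L"
  define w where "w x = q * (basis_vec s x - basis_vec t x)" for x
  define \<phi> where "\<phi> y = (\<Sum>z\<in>?V. w z * ?X z y)" for y
  have w0: "(\<Sum>x\<in>?V. w x) = 0"
    using assms pair_finite_verts
    by (simp add: w_def basis_vec_def sum_subtractf flip: sum_distrib_left)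
  show "sum (current \<phi>) (out_arcs G x) - sum (current \<phi>) (in_arcs G x) =
      q * (basis_vec s x - basis_vec t x)" if "x \<in> ?V" for x
    using pseudoinverse_potential[OF w0 that] laplacian_apply[OF that, of \<phi>]
    by (simp add: \<phi>_def w_def)
  have "potential_diff G a q s t u v =
        (\<Sum>x\<in>?V. \<Sum>y\<in>?V. w x * ?X x y * (basis_vec u y - basis_vec v y))"
    by (simp add: potential_diff_def w_def sum_distrib_left mult.assoc)
  also have "\<dots> = (\<Sum>y\<in>?V. \<phi> y * (basis_vec u y - basis_vec v y))"
    unfolding \<phi>_def sum_distrib_right by (rule sum.swap)
  also have "\<dots> = \<phi> u - \<phi> v"
    using assms pair_finite_verts
    by (simp add: basis_vec_def right_diff_distrib sum_subtractf if_distrib[of "\<lambda>c. _ * c"] cong: if_cong)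
  finally show "potential_diff G a q s t u v = \<phi> u - \<phi> v" .
qed

end

section \<open>The grid\<close>

text \<open>The Laplacian of the grid in coordinates with unit resistances; the guards drop the
  edges missing at the border. With curried coordinates, exchanging the axes is a swap of
  arguments.\<close>

definition grid_outflow :: "nat \<Rightarrow> nat \<Rightarrow> (nat \<Rightarrow> nat \<Rightarrow> real) \<Rightarrow> nat \<Rightarrow> nat \<Rightarrow> real" where
  "grid_outflow m n p i j =
     (if i < m then p i j - p (Suc i) j else 0) - (if 0 < i then p (i - 1) j - p i j else 0) +
     ((if j < n then p i j - p i (Suc j) else 0) - (if 0 < j then p i (j - 1) - p i j else 0))"

lemma grid_outflow_transpose: "grid_outflow n m (\<lambda>j i. p i j) j i = grid_outflow m n p i j"
  by (simp add: grid_outflow_def)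

text \<open>The horizontal differences of the potential are superharmonic on the grid of horizontal edges,
  with value 0 on the columns just outside of it, so a minimum principle applies.\<close>

lemma grid_potential_decreasing:
  assumes source: "\<And>i j. i \<le> m \<Longrightarrow> j \<le> n \<Longrightarrow> (i, j) \<noteq> (m, n) \<Longrightarrow> 0 \<le> grid_outflow m n p i j"
    and sink: "\<And>i j. i \<le> m \<Longrightarrow> j \<le> n \<Longrightarrow> (i, j) \<noteq> (0, 0) \<Longrightarrow> grid_outflow m n p i j \<le> 0"
    and "i < m" "j \<le> n"
  shows "p (Suc i) j \<le> p i j"
proof (rule ccontr)
  assume neg: "\<not> p (Suc i) j \<le> p i j"
  define D where "D x y = p x y - p (Suc x) y" for x y
  define S where "S = {..<m} \<times> {..n}"
  define \<mu> where "\<mu> = Min (case_prod D ` S)"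
  have S: "finite (case_prod D ` S)" "case_prod D ` S \<noteq> {}"
    using assms(3,4) by (auto simp: S_def)
  have \<mu>_le: "\<mu> \<le> D x y" if "x < m" "y \<le> n" for x y
    unfolding \<mu>_def using that by (intro Min_le S) (force simp: S_def)
  have \<mu>_neg: "\<mu> < 0"
    using \<mu>_le[OF assms(3,4)] neg by (simp add: D_def)
  have "\<mu> \<in> case_prod D ` S"
    unfolding \<mu>_def by (rule Min_in[OF S])
  then obtain z where "z \<in> S \<and> case_prod D z = \<mu>" by auto
  \<comment> \<open>A leftmost minimizer is chosen, which makes the comparison with its left
    neighbour strict.\<close>
  from ex_has_least_nat[of "\<lambda>z. z \<in> S \<and> case_prod D z = \<mu>", OF this, of fst]
  obtain x y where xy: "x < m" "y \<le> n" "D x y = \<mu>"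
    and least: "\<And>x' y'. x' < m \<Longrightarrow> y' \<le> n \<Longrightarrow> D x' y' = \<mu> \<Longrightarrow> x \<le> x'"
    by (auto simp: S_def)
  have left: "\<mu> < D (x - 1) y" if "0 < x"
  proof -
    have "x - 1 < m" "\<not> x \<le> x - 1" using xy(1) that by linarith+
    then show ?thesis
      using least[OF _ xy(2)] \<mu>_le[OF _ xy(2)] by (metis order_le_less)
  qed
  have right: "Suc x < m \<Longrightarrow> \<mu> \<le> D (Suc x) y"
    and up: "y < n \<Longrightarrow> \<mu> \<le> D x (Suc y)" and down: "0 < y \<Longrightarrow> \<mu> \<le> D x (y - 1)"
    using \<mu>_le xy by auto
  \<comment> \<open>Kirchhoff's law is differenced along the minimizing edge, so each term compares
    \<open>D x y\<close> with a neighbour. Beyond the left and right sides the neighbour is 0,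
    larger than \<open>\<mu>\<close>; beyond the bottom and top the term is absent.\<close>
  have "grid_outflow m n p x y - grid_outflow m n p (Suc x) y =
        D x y - (if 0 < x then D (x - 1) y else 0) + (D x y - (if Suc x < m then D (Suc x) y else 0)) +
        (if y < n then D x y - D x (Suc y) else 0) + (if 0 < y then D x y - D x (y - 1) else 0)"
    using xy by (auto simp: grid_outflow_def D_def)
  also have "\<dots> < 0"
    using left right up down \<mu>_neg xy(3) by auto
  \<comment> \<open>The left end of the edge is not the sink \<open>(m, n)\<close> and its right end
    is not the source \<open>(0, 0)\<close>, so the outflows there have the opposite signs.\<close>
  finally show False
    using source[of x y] sink[of "Suc x" y] xy by simp
qed

section \<open>The grid as a finite digraph\<close>

lemma pverts_grid: "pverts (grid m n) = {0..m} \<times> {0..n}"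
  by (simp add: grid_def)

lemma parcs_grid_iff:
  "((i, j), (i', j')) \<in> parcs (grid m n) \<longleftrightarrow>
     i' = Suc i \<and> j' = j \<and> i < m \<and> j \<le> n \<or> i' = i \<and> j' = Suc j \<and> i \<le> m \<and> j < n"
  by (auto simp: grid_def)

lemma out_arcs_grid:
  assumes "i \<le> m" "j \<le> n"
  shows "out_arcs (grid m n) (i, j) =
    (if i < m then {((i, j), (Suc i, j))} else {}) \<union> (if j < n then {((i, j), (i, Suc j))} else {})"
  using assms by (auto simp: out_arcs_def parcs_grid_iff)

lemma in_arcs_grid:
  assumes "i \<le> m" "j \<le> n"
  shows "in_arcs (grid m n) (i, j) =
    (if 0 < i then {((i - 1, j), (i, j))} else {}) \<union> (if 0 < j then {((i, j - 1), (i, j))} else {})"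
  using assms by (auto simp: in_arcs_def parcs_grid_iff)

lemma finite_parcs_grid: "finite (parcs (grid m n))"
  by (rule finite_subset[of _ "({0..m} \<times> {0..n}) \<times> ({0..m} \<times> {0..n})"]) (auto simp: grid_def)

lemma pair_fin_digraph_grid: "pair_fin_digraph (grid m n)"
  using finite_parcs_grid by unfold_locales (auto simp: grid_def)

lemma reachable_grid:
  assumes "i \<le> m" "j \<le> n"
  shows "(0, 0) \<rightarrow>\<^sup>*\<^bsub>grid m n\<^esub> (i, j)"
proof -
  interpret pair_fin_digraph "grid m n" by (rule pair_fin_digraph_grid)
  have "(0, 0) \<rightarrow>\<^sup>*\<^bsub>grid m n\<^esub> (i, 0)" using assms(1)
  proof (induction i)
    case 0
    then show ?case by (simp add: pverts_grid)
  next
    case (Suc i)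
    then have "(0, 0) \<rightarrow>\<^sup>*\<^bsub>grid m n\<^esub> (i, 0)" by simp
    moreover have "((i, 0), (Suc i, 0)) \<in> parcs (grid m n)"
      using Suc.prems by (simp add: parcs_grid_iff)
    ultimately show ?case by (rule reachable_adj_trans)
  qed
  then show ?thesis using assms(2)
  proof (induction j)
    case 0
    then show ?case by simp
  next
    case (Suc j)
    then have "(0, 0) \<rightarrow>\<^sup>*\<^bsub>grid m n\<^esub> (i, j)" by simp
    moreover have "((i, j), (i, Suc j)) \<in> parcs (grid m n)"
      using assms(1) Suc.prems by (simp add: parcs_grid_iff)
    ultimately show ?case by (rule reachable_adj_trans)
  qed
qed

lemma rooted_network_grid:
  assumes "a > 0"
  shows "rooted_network (grid m n) (0, 0) a"
proof -
  interpret pair_fin_digraph "grid m n" by (rule pair_fin_digraph_grid)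
  show ?thesis
    using assms reachable_grid by unfold_locales (auto simp: parcs_grid_iff pverts_grid)
qed

section \<open>The electrical current as equilibrium of the grid\<close>

text \<open>Kirchhoff's law gives conservation and the demand \<open>q\<close>; nonnegativity comes
  from the minimum principle, applied to the grid and to its transpose.\<close>

lemma grid_electrical_flow:
  fixes a q :: real
  assumes "m \<ge> 1" "n \<ge> 1" "q > 0" "a > 0"
    and "u \<in> pverts (grid m n)" "v \<in> pverts (grid m n)"
  obtains \<phi> where
    "feasible_flow (grid m n) (0, 0) (m, n) q (\<lambda>e. (\<phi> (fst e) - \<phi> (snd e)) / a)"
    and "potential_diff (grid m n) a q (0, 0) (m, n) u v = \<phi> u - \<phi> v"
proof -
  interpret rooted_network "grid m n" "(0, 0)" a
    by (rule rooted_network_grid) fact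
  let ?G = "grid m n"
  obtain \<phi> where out: "\<And>x. x \<in> pverts ?G \<Longrightarrow>
      sum (current \<phi>) (out_arcs ?G x) - sum (current \<phi>) (in_arcs ?G x) =
      q * (basis_vec (0, 0) x - basis_vec (m, n) x)"
    and V: "potential_diff ?G a q (0, 0) (m, n) u v = \<phi> u - \<phi> v"
    by (rule potential_diff_potential[of "(0, 0)" "(m, n)" u v q])
      (use assms in \<open>auto simp: pverts_grid\<close>)
  define p where "p i j = \<phi> (i, j)" for i j
  have kirchhoff: "grid_outflow m n p i j =
      a * (q * (basis_vec (0, 0) (i, j) - basis_vec (m, n) (i, j)))"
    if ij: "i \<le> m" "j \<le> n" for i j
  proof -
    have "sum (current \<phi>) (out_arcs ?G (i, j)) - sum (current \<phi>) (in_arcs ?G (i, j)) =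
          grid_outflow m n p i j / a"
      unfolding out_arcs_grid[OF ij] in_arcs_grid[OF ij]
      by (auto simp: current_def grid_outflow_def p_def add_divide_distrib diff_divide_distrib)
    moreover have "(i, j) \<in> pverts ?G" using ij by (simp add: pverts_grid)
    ultimately show ?thesis using out[of "(i, j)"] assms(4) by (simp add: field_simps)
  qed
  have source: "0 \<le> grid_outflow m n p i j" if "i \<le> m" "j \<le> n" "(i, j) \<noteq> (m, n)" for i j
    using that assms by (simp only: kirchhoff) (auto simp: basis_vec_def)
  have sink: "grid_outflow m n p i j \<le> 0" if "i \<le> m" "j \<le> n" "(i, j) \<noteq> (0, 0)" for i j
    using that assms by (simp only: kirchhoff) (auto simp: basis_vec_def)
  have horizontal: "p (Suc i) j \<le> p i j" if "i < m" "j \<le> n" for i j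
    by (rule grid_potential_decreasing[OF source sink that])
  have vertical: "p i (Suc j) \<le> p i j" if "i \<le> m" "j < n" for i j
  proof (rule grid_potential_decreasing[where p = "\<lambda>j i. p i j"])
    show "0 \<le> grid_outflow n m (\<lambda>j i. p i j) y x" if "y \<le> n" "x \<le> m" "(y, x) \<noteq> (n, m)" for x y
      unfolding grid_outflow_transpose[of n m p y x] using source that by auto
    show "grid_outflow n m (\<lambda>j i. p i j) y x \<le> 0" if "y \<le> n" "x \<le> m" "(y, x) \<noteq> (0, 0)" for x y
      unfolding grid_outflow_transpose[of n m p y x] using sink that by auto
  qed fact+
  have nonneg: "0 \<le> current \<phi> e" if "e \<in> parcs ?G" for e
    using that horizontal vertical assms
    by (cases e) (auto simp: current_def p_def parcs_grid_iff)
  have "feasible_flow ?G (0, 0) (m, n) q (current \<phi>)"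
    unfolding feasible_flow_def
  proof (intro conjI ballI)
    show "0 \<le> current \<phi> e" if "e \<in> arcs ?G" for e
      using nonneg that by simp
    show "sum (current \<phi>) (out_arcs ?G w) = sum (current \<phi>) (in_arcs ?G w)"
      if "w \<in> verts ?G - {(0, 0), (m, n)}" for w
      using out[of w] that by (simp add: basis_vec_def)
    show "sum (current \<phi>) (out_arcs ?G (0, 0)) - sum (current \<phi>) (in_arcs ?G (0, 0)) = q"
      using out[of "(0, 0)"] assms by (simp add: basis_vec_def pverts_grid)
    show "sum (current \<phi>) (in_arcs ?G (m, n)) - sum (current \<phi>) (out_arcs ?G (m, n)) = q"
      using out[of "(m, n)"] assms by (simp add: basis_vec_def pverts_grid)
  qed
  then show ?thesis using that[of \<phi>] V by (simp add: current_def[abs_def])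
qed

text \<open>The level \<open>i + j\<close> rises by 1 along every arc, so pairing \<open>f\<close>
  with the negated level counts each arc once. The constant part of the latency thus costs every
  feasible flow the same.\<close>

lemma grid_flow_total:
  assumes "feasible_flow (grid m n) (0, 0) (m, n) q f" "m \<ge> 1"
  shows "sum f (parcs (grid m n)) = q * (real m + real n)"
proof -
  interpret pair_fin_digraph "grid m n" by (rule pair_fin_digraph_grid)
  define \<psi> :: "nat \<times> nat \<Rightarrow> real" where "\<psi> x = - (real (fst x) + real (snd x))" for x
  have "sum f (parcs (grid m n)) = (\<Sum>e\<in>parcs (grid m n). f e * (\<psi> (fst e) - \<psi> (snd e)))"
    by (intro sum.cong refl) (auto simp: \<psi>_def parcs_grid_iff)
  also have "\<dots> = q * (\<psi> (0, 0) - \<psi> (m, n))"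
    using assms by (intro feasible_flow_potential) (auto simp: pverts_grid)
  finally show ?thesis by (simp add: \<psi>_def)
qed

text \<open>Once the terms with \<open>b\<close> cancel, the variational inequality against the
  current \<open>f0\<close> bounds the pairing of \<open>f\<close> with itself by that with
  \<open>f0\<close>. Since \<open>f0\<close> is a potential difference, all feasible flows pair
  equally with it, and the squared distance of \<open>f\<close> from \<open>f0\<close> is at most
  0.\<close>

lemma grid_user_equilibrium_electrical:
  fixes a b q :: real
  assumes "m \<ge> 1" "q > 0" "a > 0" "b \<ge> 0"
    and ue: "user_equilibrium (grid m n) (grid_latency a b) (0, 0) (m, n) q f"
    and el: "feasible_flow (grid m n) (0, 0) (m, n) q (\<lambda>e. (\<phi> (fst e) - \<phi> (snd e)) / a)"
    and e: "e \<in> parcs (grid m n)"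
  shows "a * f e = \<phi> (fst e) - \<phi> (snd e)"
proof -
  interpret pair_fin_digraph "grid m n" by (rule pair_fin_digraph_grid)
  let ?E = "parcs (grid m n)"
  define f0 where "f0 = (\<lambda>e. (\<phi> (fst e) - \<phi> (snd e)) / a)"
  have f: "feasible_flow (grid m n) (0, 0) (m, n) q f"
    using ue by (simp add: user_equilibrium_def)
  note f0 = el[folded f0_def]
  have "total_travel_time (grid m n) (grid_latency a b) f \<le> (\<Sum>e\<in>?E. f0 e * grid_latency a b e (f e))"
    using assms f reachable_grid
    by (intro user_equilibrium_variational[OF ue f0, simplified])
      (auto simp: pverts_grid grid_latency_def feasible_flow_def)
  then have "a * (\<Sum>e\<in>?E. f e * f e) + b * sum f ?E \<le> a * (\<Sum>e\<in>?E. f0 e * f e) + b * sum f0 ?E"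
    by (simp add: total_travel_time_def grid_latency_def algebra_simps sum.distrib sum_distrib_left)
  then have vi: "(\<Sum>e\<in>?E. f e * f e) \<le> (\<Sum>e\<in>?E. f0 e * f e)"
    using assms by (simp add: grid_flow_total[OF f] grid_flow_total[OF f0])
  have pot: "(\<Sum>e\<in>?E. h e * f0 e) = q * (\<phi> (0, 0) - \<phi> (m, n)) / a"
    if "feasible_flow (grid m n) (0, 0) (m, n) q h" for h
    using feasible_flow_potential[OF that, of \<phi>] assms
    by (simp add: f0_def pverts_grid flip: sum_divide_distrib)
  have "(\<Sum>e\<in>?E. (f e - f0 e)\<^sup>2) =
        (\<Sum>e\<in>?E. f e * f e) - (\<Sum>e\<in>?E. f0 e * f e) - ((\<Sum>e\<in>?E. f e * f0 e) - (\<Sum>e\<in>?E. f0 e * f0 e))"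
    unfolding sum_subtractf[symmetric]
    by (intro sum.cong refl) (simp add: power2_eq_square algebra_simps)
  also have "\<dots> \<le> 0"
    using vi by (simp add: pot[OF f] pot[OF f0])
  finally have "(\<Sum>e\<in>?E. (f e - f0 e)\<^sup>2) = 0"
    by (intro antisym sum_nonneg) auto
  then have "f e = f0 e"
    using e finite_parcs_grid by (auto simp: sum_nonneg_eq_0_iff)
  then show ?thesis using assms by (simp add: f0_def)
qed

section \<open>Comparison of the old and the new equilibrium\<close>

lemma braess_inequality:
  fixes m n :: nat
    and q a b c d :: real
    and u v :: "nat \<times> nat"
    and f g :: "(nat \<times> nat) \<times> (nat \<times> nat) \<Rightarrow> real"
  assumes "m \<ge> 1" "n \<ge> 1" "q > 0" "a > 0" "b \<ge> 0" "c \<ge> 0" "d \<ge> 0"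
    and chord: "is_chord (grid m n) u v"
    and f: "user_equilibrium (grid m n) (grid_latency a b) (0, 0) (m, n) q f"
    and g: "user_equilibrium (add_chord (grid m n) u v) (chord_latency a b c d u v) (0, 0) (m, n) q g"
  shows "total_travel_time (add_chord (grid m n) u v) (chord_latency a b c d u v) g
      \<le> total_travel_time (grid m n) (grid_latency a b) f
        - potential_diff (grid m n) a q (0, 0) (m, n) u v * g (u, v)"
proof -
  let ?G = "grid m n" and ?H = "add_chord (grid m n) u v" and ?E = "parcs (grid m n)"
  interpret G: pair_fin_digraph ?G by (rule pair_fin_digraph_grid)
  have uv: "u \<in> pverts ?G" "v \<in> pverts ?G" "(u, v) \<notin> ?E"
    using chord by (auto simp: is_chord_def parcs_mk_symmetric)
  obtain \<phi> where el: "feasible_flow ?G (0, 0) (m, n) q (\<lambda>e. (\<phi> (fst e) - \<phi> (snd e)) / a)"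
    and V: "potential_diff ?G a q (0, 0) (m, n) u v = \<phi> u - \<phi> v"
    using grid_electrical_flow[OF assms(1-4) uv(1,2)] by blast
  have af: "a * f e = \<phi> (fst e) - \<phi> (snd e)" if "e \<in> ?E" for e
    using grid_user_equilibrium_electrical[OF assms(1,3,4,5) f el that] .
  have ff: "feasible_flow ?G (0, 0) (m, n) q f" and gf: "feasible_flow ?H (0, 0) (m, n) q g"
    using f g by (simp_all add: user_equilibrium_def)
  have H_simps: "verts ?H = pverts ?G" "arcs ?H = insert (u, v) ?E" "tail ?H = fst" "head ?H = snd"
    using uv by (auto simp: pre_digraph.verts_add_arc_conv pre_digraph.arcs_add_arc
        pre_digraph.tail_add_arc pre_digraph.head_add_arc)
  interpret H: fin_digraph ?H
    by unfold_locales (use uv G.pair_finite_verts G.pair_finite_arcs in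
      \<open>auto simp: H_simps dest: G.wellformed'\<close>)
  have "subgraph (with_proj ?G) ?H"
    using G.wf_digraph H.wf_digraph by (intro subgraphI) (auto simp: H_simps compatible_def)
  then have H_reach: "(0, 0) \<rightarrow>\<^sup>*\<^bsub>?H\<^esub> x" if "x \<in> verts ?H" for x
    using that reachable_grid[of "fst x" m "snd x" n]
    by (intro H.reachable_mono[of "with_proj ?G"]) (auto simp: H_simps pverts_grid)
  \<comment> \<open>\<open>f\<close> is unconstrained off the grid arcs; with the value 0 on the
    chord it becomes a feasible flow of the augmented network, and the chord latency drops out of
    the test against it.\<close>
  define f' where "f' = f((u, v) := 0)"
  have f'E: "f' e = f e" if "e \<in> ?E" for e
    using that uv by (auto simp: f'_def)
  have sum_arcs: "sum f' (out_arcs ?H x) = sum f (out_arcs ?G x)"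
    "sum f' (in_arcs ?H x) = sum f (in_arcs ?G x)" for x
    by (rule sum.mono_neutral_cong_right; use uv G.pair_finite_arcs f'E in
        \<open>auto simp: out_arcs_def in_arcs_def H_simps f'_def\<close>)+
  have f'f: "feasible_flow ?H (0, 0) (m, n) q f'"
    using ff f'E by (auto simp: feasible_flow_def sum_arcs H_simps) (simp add: f'_def)
  have "total_travel_time ?H (chord_latency a b c d u v) g \<le>
        (\<Sum>e\<in>arcs ?H. f' e * chord_latency a b c d u v e (g e))"
    using assms gf H_reach
    by (intro H.user_equilibrium_variational[OF g f'f])
      (auto simp: H_simps pverts_grid chord_latency_def grid_latency_def feasible_flow_def)
  also have "\<dots> = (\<Sum>e\<in>?E. f e * (a * g e + b))"
    using uv G.pair_finite_arcs unfolding H_simps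
    by (intro sum.mono_neutral_cong_right)
      (auto simp: f'_def chord_latency_def grid_latency_def)
  \<comment> \<open>Reciprocity: in the bilinear term \<open>f e * (a * g e)\<close> the factor
    \<open>a\<close> moves over to \<open>f e\<close>, where it produces the voltage of the
    arc.\<close>
  also have "\<dots> = (\<Sum>e\<in>?E. g e * (\<phi> (fst e) - \<phi> (snd e))) + b * sum f ?E"
    by (simp add: algebra_simps sum.distrib sum_distrib_left flip: af)
  \<comment> \<open>Conservation of \<open>g\<close> holds in the augmented network, so its chord
    term has to be split off; this is where the voltage between \<open>u\<close> and
    \<open>v\<close> enters.\<close>
  also have "(\<Sum>e\<in>?E. g e * (\<phi> (fst e) - \<phi> (snd e))) =
             q * (\<phi> (0, 0) - \<phi> (m, n)) - g (u, v) * (\<phi> u - \<phi> v)"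
    using H.feasible_flow_potential[OF gf, of \<phi>] uv assms(1,2) G.pair_finite_arcs
    by (simp add: H_simps pverts_grid)
  also have "q * (\<phi> (0, 0) - \<phi> (m, n)) = (\<Sum>e\<in>?E. f e * (\<phi> (fst e) - \<phi> (snd e)))"
    using G.feasible_flow_potential[OF ff, of \<phi>] assms(1,2) by (simp add: pverts_grid)
  also have "(\<Sum>e\<in>?E. f e * (\<phi> (fst e) - \<phi> (snd e))) - g (u, v) * (\<phi> u - \<phi> v) + b * sum f ?E =
             total_travel_time ?G (grid_latency a b) f - g (u, v) * (\<phi> u - \<phi> v)"
    by (simp add: total_travel_time_def grid_latency_def algebra_simps sum.distrib sum_distrib_left
        flip: af)
  finally show ?thesis by (simp add: V mult.commute)
qed

theorem theorem2p14:
  fixes m n :: nat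
    and q a b c d :: real
    and s t u v :: "nat \<times> nat"
    and f g :: "(nat \<times> nat) \<times> (nat \<times> nat) \<Rightarrow> real"
    and C_old C_new z V_uv :: real
  assumes "m \<ge> 1" and "n \<ge> 1"
    and "q > 0" and "a > 0" and "b \<ge> 0" and "c \<ge> 0" and "d \<ge> 0"
    and "s = (0, 0)" and "t = (m, n)"
    and "is_chord (grid m n) u v"
    and "user_equilibrium (grid m n) (grid_latency a b) s t q f"
    and "user_equilibrium (add_chord (grid m n) u v) (chord_latency a b c d u v) s t q g"
    and "C_old = total_travel_time (grid m n) (grid_latency a b) f"
    and "C_new = total_travel_time (add_chord (grid m n) u v) (chord_latency a b c d u v) g"
    and "z = g (u, v)"
    and "V_uv = potential_diff (grid m n) a q s t u v"
  shows "(0 < z \<and> z \<le> q \<longrightarrow> C_new - C_old \<le> - V_uv * z) \<and>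
         (C_new > C_old \<longrightarrow> V_uv < 0)"
proof -
  have le: "C_new - C_old \<le> - V_uv * z"
    using braess_inequality[of m n q a b c d u v f g] assms by simp
  \<comment> \<open>The second claim also covers a chord without flow, so its proof starts from
    nonnegativity.\<close>
  have z: "0 \<le> z"
    using assms(12,15) by (simp add: user_equilibrium_def feasible_flow_def pre_digraph.arcs_add_arc)
  have "V_uv < 0" if "C_new > C_old"
  proof (rule ccontr)
    assume "\<not> V_uv < 0"
    with z have "0 \<le> V_uv * z" by simp
    with le that show False by simp
  qed
  with le show ?thesis by blast
qed

end
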